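(* Let $H$ be a real separable Hilbert space, let $R:H\to H$ be a bounded linear self-adjoint operator, and let $f\in\mathrm{BUC}^\alpha_R(H)$ for some $\alpha\in(0,1)$. For $t>0$ let $$S^R(t)f(x):=\sup_{h\in H_R}\left\{\inf_{k\in H_R}\left\{f(x+k-h)+\frac{1}{2t}\|k\|_{H_R}^2\right\}-\frac{1}{t}\|h\|_{H_R}^2\right\},\qquad x\in H.$$ There exists a constant $c_\alpha>0$ such that for every $t>0$ and $x\in H$ it holds $$\|S^R(t)f\|_\infty\leq\|f\|_\infty;$$ $$0\leq f(x)-S^R(t)f(x)\leq c_\alpha [f]_{R,\alpha}^{2/(2-\alpha)}t^{\alpha/(2-\alpha)};$$ $$[S^R(t)f]_R \leq 2\big(2c_\alpha [f]_{R,\alpha}^{2/(2-\alpha)}\big)^{1/2}t^{(\alpha-1)/(2-\alpha)}.$$ In particular the mapping $x\mapsto S^R(t)f(x)$ belongs to $\mathrm{Lip}_{b,R}(H)$, for every $t>0$.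
   Context: $H_R:=R(H)$, $R^{-1}:=(R_{|(\ker R)^\perp})^{-1}:H_R\to(\ker R)^\perp$ is the pseudo-inverse, and $H_R$ is a Hilbert space with norm $\|x\|_{H_R}:=\|R^{-1}x\|_H$ (inner product $\langle x,y\rangle_{H_R}:=\langle R^{-1}x,R^{-1}y\rangle_H$). $\mathrm{BUC}(H)$ is the space of bounded uniformly continuous functions $f:H\to\mathbb{R}$ with the sup norm $\|\cdot\|_\infty$. $\mathrm{BUC}^\alpha_R(H)$ is the space of $f\in\mathrm{BUC}(H)$ with $[f]_{R,\alpha}:=\sup_{x,v\in H,\,v\neq0}\frac{|f(x+Rv)-f(x)|}{\|v\|_H^\alpha}<+\infty$. $\mathrm{Lip}_{b,R}(H)$ is the space of $f\in\mathrm{BUC}(H)$ with $[f]_R:=\sup_{x,v\in H,\,v\neq0}\frac{|f(x+Rv)-f(x)|}{\|v\|_H}<+\infty$. *)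

theory Defs
  imports "HOL-Analysis.Analysis"
begin

definition self_adjoint :: "('a::real_inner \<Rightarrow> 'a) \<Rightarrow> bool" where
  "self_adjoint R \<longleftrightarrow> (\<forall>x y. R x \<bullet> y = x \<bullet> R y)"

text \<open>The inverse of the restriction of \<open>R\<close> to the orthogonal complement of its kernel; for bounded
  linear \<open>R\<close> on a Hilbert space this restriction is a bijection onto \<open>range R\<close>. Only values
  at points of \<open>range R\<close> are meaningful.\<close>

definition pinv :: "('a::real_inner \<Rightarrow> 'a) \<Rightarrow> 'a \<Rightarrow> 'a" where
  "pinv R = inv_into (orthogonal_comp {x. R x = 0}) R"

definition HR_norm :: "('a::real_inner \<Rightarrow> 'a) \<Rightarrow> 'a \<Rightarrow> real" where
  "HR_norm R h = norm (pinv R h)"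

definition BUC :: "('a::real_normed_vector \<Rightarrow> real) set" where
  "BUC = {f. bounded (range f) \<and> uniformly_continuous_on UNIV f}"

text \<open>The sup norm and the seminorms are suprema in \<open>[0,\<infinity>]\<close>: an infinite supremum is \<open>\<infinity>\<close>, and the
  supremum over the empty set (no nonzero \<open>v\<close> in the trivial space) is \<open>0\<close>.\<close>

definition sup_norm :: "('a \<Rightarrow> real) \<Rightarrow> ennreal" where
  "sup_norm f = (SUP x. ennreal \<bar>f x\<bar>)"

definition holder_seminorm ::
    "('a::real_normed_vector \<Rightarrow> 'a) \<Rightarrow> real \<Rightarrow> ('a \<Rightarrow> real) \<Rightarrow> ennreal" where
  "holder_seminorm R \<alpha> f =
     Sup {ennreal (\<bar>f (x + R v) - f x\<bar> / norm v powr \<alpha>) | x v. v \<noteq> 0}"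

definition lip_seminorm ::
    "('a::real_normed_vector \<Rightarrow> 'a) \<Rightarrow> ('a \<Rightarrow> real) \<Rightarrow> ennreal" where
  "lip_seminorm R f = Sup {ennreal (\<bar>f (x + R v) - f x\<bar> / norm v) | x v. v \<noteq> 0}"

definition BUC_holder ::
    "('a::real_normed_vector \<Rightarrow> 'a) \<Rightarrow> real \<Rightarrow> ('a \<Rightarrow> real) set" where
  "BUC_holder R \<alpha> = {f \<in> BUC. holder_seminorm R \<alpha> f < \<infinity>}"

definition Lip_b ::
    "('a::real_normed_vector \<Rightarrow> 'a) \<Rightarrow> ('a \<Rightarrow> real) set" where
  "Lip_b R = {f \<in> BUC. lip_seminorm R f < \<infinity>}"

text \<open>Infimum and supremum are taken in \<open>real\<close>. For bounded \<open>f\<close> and \<open>t > 0\<close> this is harmless: the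
  infimum is over a set bounded below by \<open>inf f\<close>, and its value is at most \<open>f (x - h)\<close> (take
  \<open>k = 0\<close>), so the supremum is over a set bounded above by \<open>sup f\<close>.\<close>

definition lasry_lions ::
    "('a::real_inner \<Rightarrow> 'a) \<Rightarrow> real \<Rightarrow> ('a \<Rightarrow> real) \<Rightarrow> 'a \<Rightarrow> real" where
  "lasry_lions R t f x =
     (SUP h\<in>range R.
        (INF k\<in>range R. f (x + k - h) + 1 / (2 * t) * (HR_norm R k)\<^sup>2)
        - 1 / t * (HR_norm R h)\<^sup>2)"

end

theory Submission
  imports Defs
begin

text \<open>
  Write \<open>N k\<close> for the norm of \<open>H_R\<close>. Orthogonal projection onto the closed
  subspace \<open>ker R\<close> shows that the pseudo-inverse picks the preimage of least norm, so
  \<open>N k\<close> is the least norm of a vector mapped to \<open>k\<close> (\<open>R_pinv\<close>,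
  \<open>HR_norm_le\<close>). This yields everything that is needed about \<open>N\<close>: the triangle inequality
  \<open>N (h + R v) \<le> N h + \<parallel>v\<parallel>\<close> and the Hoelder estimate
  \<open>\<bar>f (x + k) - f x\<bar> \<le> L * N k powr \<alpha>\<close>.

  Let \<open>V\<close> be the inner infimum, an infimal convolution of \<open>f\<close>, and let \<open>S\<close> be the
  regularization. Testing \<open>V (x - h)\<close> with \<open>k = h\<close> gives
  \<open>V (x - h) - (N h)\<^sup>2 / t \<le> f x - (N h)\<^sup>2 / (2 t)\<close>, hence \<open>S x \<le> f x\<close>; testing
  \<open>S\<close> with \<open>h = 0\<close> gives \<open>V x \<le> S x\<close>. As \<open>L s\<^sup>\<alpha> - s\<^sup>2 / (2 t)\<close> is bounded in
  \<open>s \<ge> 0\<close> by \<open>M = c L\<^bsup>2/(2-\<alpha>)\<^esup> t\<^bsup>\<alpha>/(2-\<alpha>)\<^esup>\<close>, also \<open>f x - V x \<le> M\<close>.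

  The first of these inequalities controls the near-maximizers \<open>h\<close> in \<open>S x\<close>: they satisfy, up
  to an arbitrarily small error, \<open>(N h)\<^sup>2 \<le> 2 t M\<close>. Using \<open>h + R v\<close> as a competitor at
  \<open>x + R v\<close> leaves \<open>V\<close> unchanged and alters only the penalty, so
  \<open>S x - S (x + R v) \<le> (2 sqrt (2 t M) \<parallel>v\<parallel> + \<parallel>v\<parallel>\<^sup>2) / t\<close>.
  Cutting the segment from \<open>x\<close> to \<open>x + R v\<close> into many equal pieces removes the quadratic term
  (\<open>lipschitz_by_subdivision\<close>) and leaves exactly the asserted constant. Finally, \<open>S\<close> is
  monotone in \<open>f\<close> and commutes with translations and with adding constants, so it inherits the
  modulus of continuity of \<open>f\<close>.
\<close>

section \<open>Least-norm preimages\<close>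

text \<open>The classical minimizing-sequence argument: by the parallelogram law, points of \<open>K\<close> that
  almost realize the distance from \<open>u\<close> are close to each other, and at the limit the first
  variation of the distance vanishes in every direction of \<open>K\<close>.\<close>

lemma orthogonal_projection_exists:
  fixes K :: "'a::{real_inner, complete_space} set"
  assumes "closed K" and K: "subspace K"
  obtains p where "p \<in> K" and "\<And>k. k \<in> K \<Longrightarrow> (u - p) \<bullet> k = 0"
proof -
  define D where "D = (INF p\<in>K. (norm (u - p))\<^sup>2)"
  have ne: "K \<noteq> {}" using subspace_0[OF K] by auto
  have bdd: "bdd_below ((\<lambda>p. (norm (u - p))\<^sup>2) ` K)"
    by (rule bdd_belowI2[where m = 0]) simp
  have D_le: "D \<le> (norm (u - p))\<^sup>2" if "p \<in> K" for p
    unfolding D_def using bdd that by (rule cINF_lower)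
  have "\<exists>p\<in>K. (norm (u - p))\<^sup>2 < D + 1 / real (Suc n)" for n
    using cInf_lessD[of "(\<lambda>p. (norm (u - p))\<^sup>2) ` K" "D + 1 / real (Suc n)"] ne
    by (auto simp: D_def)
  then obtain p where pK: "\<And>n. p n \<in> K"
    and pD: "\<And>n. (norm (u - p n))\<^sup>2 < D + 1 / real (Suc n)" by metis
  have close: "(norm (p m - p n))\<^sup>2 \<le> 2 * (1 / real (Suc m)) + 2 * (1 / real (Suc n))" for m n
  proof -
    have mid: "(1/2) *\<^sub>R (p m + p n) \<in> K"
      by (intro subspace_scale[OF K] subspace_add[OF K] pK)
    have "(norm (p m - p n))\<^sup>2 = 2 * (norm (u - p m))\<^sup>2 + 2 * (norm (u - p n))\<^sup>2
        - 4 * (norm (u - (1/2) *\<^sub>R (p m + p n)))\<^sup>2"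
      by (simp add: power2_norm_eq_inner inner_simps inner_commute algebra_simps)
    then show ?thesis using D_le[OF mid] pD[of m] pD[of n] by simp
  qed
  have "Cauchy p"
  proof (rule metric_CauchyI)
    fix e :: real assume "e > 0"
    obtain n0 where n0: "1 / real (Suc n0) < e\<^sup>2 / 4"
      using nat_approx_posE[of "e\<^sup>2 / 4"] \<open>e > 0\<close> by auto
    have "dist (p m) (p n) < e" if "m \<ge> n0" "n \<ge> n0" for m n
    proof -
      have "1 / real (Suc m) \<le> 1 / real (Suc n0)" "1 / real (Suc n) \<le> 1 / real (Suc n0)"
        using that by (auto simp: field_simps)
      then have "(norm (p m - p n))\<^sup>2 < e\<^sup>2"
        using close[of m n] n0 by linarith
      then show ?thesis using \<open>e > 0\<close> by (simp add: dist_norm power2_less_imp_less)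
    qed
    then show "\<exists>M. \<forall>m\<ge>M. \<forall>n\<ge>M. dist (p m) (p n) < e" by blast
  qed
  then obtain q where q: "p \<longlonglongrightarrow> q" using Cauchy_convergent convergent_def by blast
  have qK: "q \<in> K" using closed_sequentially[OF \<open>closed K\<close>] pK q by blast
  have "(norm (u - q))\<^sup>2 \<le> D + 0"
  proof (rule LIMSEQ_le)
    show "(\<lambda>n. (norm (u - p n))\<^sup>2) \<longlonglongrightarrow> (norm (u - q))\<^sup>2"
      by (intro tendsto_intros q)
    show "(\<lambda>n. D + 1 / real (Suc n)) \<longlonglongrightarrow> D + 0"
      using LIMSEQ_inverse_real_of_nat by (intro tendsto_intros) (simp add: field_simps)
    show "\<exists>N. \<forall>n\<ge>N. (norm (u - p n))\<^sup>2 \<le> D + 1 / real (Suc n)"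
      using pD less_imp_le by blast
  qed
  then have qmin: "(norm (u - q))\<^sup>2 \<le> (norm (u - p))\<^sup>2" if "p \<in> K" for p
    using D_le[OF that] by linarith
  have "(u - q) \<bullet> k = 0" if "k \<in> K" for k
  proof (cases "k = 0")
    case False
    \<comment> \<open>the step along \<open>k\<close> that would minimize the distance\<close>
    define s where "s = (u - q) \<bullet> k / (k \<bullet> k)"
    have kk: "k \<bullet> k > 0" using False by simp
    have "q + s *\<^sub>R k \<in> K"
      by (intro subspace_add[OF K] subspace_scale[OF K] qK that)
    then have "(norm (u - q))\<^sup>2 \<le> (norm ((u - q) - s *\<^sub>R k))\<^sup>2"
      using qmin by (metis diff_diff_add)
    also have "\<dots> = (norm (u - q))\<^sup>2 - 2 * s * ((u - q) \<bullet> k) + s * (s * (k \<bullet> k))"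
      unfolding power2_norm_eq_inner
      by (simp add: inner_simps inner_commute algebra_simps)
    also have "s * (k \<bullet> k) = (u - q) \<bullet> k" using kk by (simp add: s_def)
    finally have "s * ((u - q) \<bullet> k) \<le> 0" by simp
    then have "((u - q) \<bullet> k)\<^sup>2 \<le> 0"
      using kk by (simp add: s_def power2_eq_square divide_le_0_iff)
    then show ?thesis by simp
  qed simp
  with qK that show thesis by blast
qed

text \<open>Subtracting from a preimage its projection onto the kernel gives a preimage orthogonal to the
  kernel, so the choice made by \<open>pinv\<close> is a genuine one.\<close>

lemma
  fixes R :: "'a::{real_inner, complete_space} \<Rightarrow> 'a"
  assumes R: "bounded_linear R" and k: "k \<in> range R"
  shows R_pinv: "R (pinv R k) = k"
    and pinv_orthogonal: "R v = 0 \<Longrightarrow> pinv R k \<bullet> v = 0"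
proof -
  interpret R: bounded_linear R by (rule R)
  let ?K = "{x. R x = 0}"
  have "closed ?K"
    by (intro closed_Collect_eq continuous_intros linear_continuous_on R)
  moreover have "subspace ?K" by (auto simp: subspace_def R.zero R.add R.scaleR)
  moreover obtain u where u: "k = R u" using k by auto
  ultimately obtain p where p: "R p = 0" "\<And>v. R v = 0 \<Longrightarrow> (u - p) \<bullet> v = 0"
    using orthogonal_projection_exists[of ?K u] by auto
  then have "u - p \<in> orthogonal_comp ?K"
    by (auto simp: orthogonal_comp_def orthogonal_def inner_commute)
  moreover have "R (u - p) = k" using u p by (simp add: R.diff)
  ultimately have *: "k \<in> R ` orthogonal_comp ?K" by blast
  show "R (pinv R k) = k" unfolding pinv_def by (rule f_inv_into_f[OF *])
  show "pinv R k \<bullet> v = 0" if "R v = 0"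
    using inv_into_into[OF *] that
    by (auto simp: pinv_def orthogonal_comp_def orthogonal_def inner_commute)
qed

text \<open>Pythagoras: \<open>u\<close> differs from \<open>pinv R (R u)\<close> by a kernel vector, to which the latter is
  orthogonal.\<close>

lemma HR_norm_le:
  fixes R :: "'a::{real_inner, complete_space} \<Rightarrow> 'a"
  assumes R: "bounded_linear R"
  shows "HR_norm R (R u) \<le> norm u"
proof -
  interpret R: bounded_linear R by (rule R)
  let ?w = "pinv R (R u)"
  have "R (u - ?w) = 0" using R_pinv[OF R, of "R u"] by (simp add: R.diff)
  then have 0: "?w \<bullet> (u - ?w) = 0" by (intro pinv_orthogonal[OF R]) auto
  have "(norm u)\<^sup>2 = (norm (?w + (u - ?w)))\<^sup>2" by simp
  also have "\<dots> = (norm ?w)\<^sup>2 + (norm (u - ?w))\<^sup>2"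
    by (subst norm_add_Pythagorean) (use 0 in \<open>auto simp: orthogonal_def\<close>)
  finally have "(norm ?w)\<^sup>2 \<le> (norm u)\<^sup>2" by simp
  then show ?thesis unfolding HR_norm_def by (rule power2_le_imp_le) simp
qed

lemma HR_norm_nonneg: "0 \<le> HR_norm R k"
  by (simp add: HR_norm_def)

lemma HR_norm_0:
  fixes R :: "'a::{real_inner, complete_space} \<Rightarrow> 'a"
  assumes "bounded_linear R"
  shows "HR_norm R 0 = 0"
  using HR_norm_le[OF assms, of 0] HR_norm_nonneg[of R 0]
  by (simp add: linear_0[OF bounded_linear.linear[OF assms]])

lemma HR_norm_add_le:
  fixes R :: "'a::{real_inner, complete_space} \<Rightarrow> 'a"
  assumes R: "bounded_linear R" and h: "h \<in> range R"
  shows "HR_norm R (h + R v) \<le> HR_norm R h + norm v"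
proof -
  have "h + R v = R (pinv R h + v)"
    using R_pinv[OF R h] by (simp add: linear_add[OF bounded_linear.linear[OF R]])
  then have "HR_norm R (h + R v) \<le> norm (pinv R h + v)"
    using HR_norm_le[OF R] by metis
  also have "\<dots> \<le> HR_norm R h + norm v"
    unfolding HR_norm_def by (rule norm_triangle_ineq)
  finally show ?thesis .
qed

section \<open>Two estimates on the real line and along segments\<close>

text \<open>Where the left-hand side is positive, \<open>s powr (2 - \<alpha>) < 2 * t * L\<close>; inserting this bound
  for \<open>s\<close> into \<open>L * s powr \<alpha>\<close> gives the right-hand side.\<close>

lemma holder_minus_quadratic_le:
  fixes L s t \<alpha> :: real
  assumes \<alpha>: "0 < \<alpha>" "\<alpha> < 1" and "0 \<le> L" "0 \<le> s" "0 < t"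
  shows "L * s powr \<alpha> - s\<^sup>2 / (2 * t)
    \<le> 2 powr (\<alpha> / (2 - \<alpha>)) * L powr (2 / (2 - \<alpha>)) * t powr (\<alpha> / (2 - \<alpha>))"
proof (cases "L * s powr \<alpha> \<le> s\<^sup>2 / (2 * t)")
  case True
  have "0 \<le> 2 powr (\<alpha> / (2 - \<alpha>)) * L powr (2 / (2 - \<alpha>)) * t powr (\<alpha> / (2 - \<alpha>))"
    by simp
  with True show ?thesis by linarith
next
  case False
  then have "s \<noteq> 0" "L \<noteq> 0" using assms by (auto simp: divide_le_0_iff)
  then have s: "s > 0" and L: "L > 0" using assms by auto
  have "s powr (2 - \<alpha>) = s\<^sup>2 / s powr \<alpha>"
    using s by (simp add: powr_diff powr_numeral)
  also have "\<dots> \<le> 2 * t * L" using False s \<open>0 < t\<close> by (simp add: field_simps)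
  finally have "(s powr (2 - \<alpha>)) powr (\<alpha> / (2 - \<alpha>)) \<le> (2 * t * L) powr (\<alpha> / (2 - \<alpha>))"
    using \<alpha> by (intro powr_mono2) auto
  then have "s powr \<alpha> \<le> (2 * t * L) powr (\<alpha> / (2 - \<alpha>))"
    using \<alpha> by (simp add: powr_powr)
  then have "L * s powr \<alpha> \<le> L * (2 * t * L) powr (\<alpha> / (2 - \<alpha>))"
    using L by simp
  also have "\<dots> = 2 powr (\<alpha> / (2 - \<alpha>)) * (L powr 1 * L powr (\<alpha> / (2 - \<alpha>)))
      * t powr (\<alpha> / (2 - \<alpha>))"
    using L \<open>0 < t\<close> by (simp add: powr_mult)
  also have "L powr 1 * L powr (\<alpha> / (2 - \<alpha>)) = L powr (2 / (2 - \<alpha>))"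
  proof -
    have "1 + \<alpha> / (2 - \<alpha>) = 2 / (2 - \<alpha>)" using \<alpha> by (simp add: field_simps)
    then show ?thesis by (metis powr_add)
  qed
  finally show ?thesis using \<open>0 < t\<close> by (smt (verit) divide_nonneg_pos zero_le_power2)
qed

text \<open>With \<open>n\<close> equal steps the linear terms still add up to \<open>A * norm v\<close>, whereas the
  quadratic terms add up to \<open>B * (norm v)\<^sup>2 / n\<close>.\<close>

lemma lipschitz_by_subdivision:
  fixes R :: "'a::real_normed_vector \<Rightarrow> 'a" and g :: "'a \<Rightarrow> real"
  assumes R: "linear R"
    and step: "\<And>x v. g x - g (x + R v) \<le> A * norm v + B * (norm v)\<^sup>2"
  shows "g x - g (x + R v) \<le> A * norm v"
proof -
  have "g x - g (x + R v) \<le> A * norm v + B * (norm v)\<^sup>2 * (1 / real (Suc n))" for n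
  proof -
    define m where "m = real (Suc n)"
    have m: "m > 0" by (simp add: m_def)
    define y where "y i = x + R ((real i / m) *\<^sub>R v)" for i
    have y: "y (Suc i) = y i + R ((1 / m) *\<^sub>R v)" for i
      by (simp add: y_def add.assoc flip: linear_add[OF R] scaleR_left_distrib)
        (simp add: add_divide_distrib add.commute)
    have "g x - g (x + R v) = g (y 0) - g (y (Suc n))"
      using m by (simp add: y_def m_def linear_0[OF R] del: of_nat_Suc)
    also have "\<dots> = (\<Sum>i<Suc n. g (y i) - g (y (Suc i)))"
      by (rule sum_lessThan_telescope'[symmetric])
    also have "\<dots> \<le> (\<Sum>i<Suc n. A * norm ((1 / m) *\<^sub>R v) + B * (norm ((1 / m) *\<^sub>R v))\<^sup>2)"
      unfolding y by (intro sum_mono step)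
    also have "\<dots> = m * (A * (norm v / m) + B * (norm v / m)\<^sup>2)"
      using m by (simp add: m_def)
    also have "\<dots> = A * norm v + B * (norm v)\<^sup>2 * (1 / m)"
      using m by (simp add: field_simps power2_eq_square)
    finally show ?thesis by (simp add: m_def)
  qed
  moreover have "(\<lambda>n. A * norm v + B * (norm v)\<^sup>2 * (1 / real (Suc n)))
      \<longlonglongrightarrow> A * norm v + B * (norm v)\<^sup>2 * 0"
    using LIMSEQ_inverse_real_of_nat by (intro tendsto_intros) (simp add: field_simps)
  ultimately have "g x - g (x + R v) \<le> A * norm v + B * (norm v)\<^sup>2 * 0"
    by (intro LIMSEQ_le_const) auto
  then show ?thesis by simp
qed

section \<open>The regularization of a bounded function\<close>

definition inf_conv :: "('a::real_inner \<Rightarrow> 'a) \<Rightarrow> real \<Rightarrow> ('a \<Rightarrow> real) \<Rightarrow> 'a \<Rightarrow> real" where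
  "inf_conv R t f y = (INF k\<in>range R. f (y + k) + 1 / (2 * t) * (HR_norm R k)\<^sup>2)"

lemma lasry_lions_eq:
  "lasry_lions R t f x = (SUP h\<in>range R. inf_conv R t f (x - h) - 1 / t * (HR_norm R h)\<^sup>2)"
  unfolding lasry_lions_def inf_conv_def by (simp add: algebra_simps)

context
  fixes R :: "'a::{real_inner, complete_space} \<Rightarrow> 'a" and f :: "'a \<Rightarrow> real" and B t :: real
  assumes R: "bounded_linear R" and f_bound: "\<And>x. \<bar>f x\<bar> \<le> B" and t: "0 < t"
begin

lemma zero_in_range: "0 \<in> range R"
  using linear_0[OF bounded_linear.linear[OF R]] by (metis rangeI)

lemma inf_conv_le:
  assumes "k \<in> range R"
  shows "inf_conv R t f y \<le> f (y + k) + 1 / (2 * t) * (HR_norm R k)\<^sup>2"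
  unfolding inf_conv_def
proof (rule cINF_lower[OF _ assms], rule bdd_belowI2[where m = "- B"])
  fix k
  have "0 \<le> 1 / (2 * t) * (HR_norm R k)\<^sup>2" using t by simp
  then show "- B \<le> f (y + k) + 1 / (2 * t) * (HR_norm R k)\<^sup>2"
    using f_bound[of "y + k"] by linarith
qed

lemma inf_conv_ge:
  assumes "\<And>k. k \<in> range R \<Longrightarrow> a \<le> f (y + k) + 1 / (2 * t) * (HR_norm R k)\<^sup>2"
  shows "a \<le> inf_conv R t f y"
  unfolding inf_conv_def using assms by (intro cINF_greatest) auto

text \<open>The test point \<open>k = h\<close>; the surplus \<open>(HR_norm R h)\<^sup>2 / (2 * t)\<close> comes from penalizing the
  outer variable twice as strongly as the inner one.\<close>

lemma inf_conv_shift_le: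
  assumes "h \<in> range R"
  shows "inf_conv R t f (x - h) - 1 / t * (HR_norm R h)\<^sup>2 \<le> f x - (HR_norm R h)\<^sup>2 / (2 * t)"
proof -
  have "1 / t * (HR_norm R h)\<^sup>2 = 1 / (2 * t) * (HR_norm R h)\<^sup>2 + (HR_norm R h)\<^sup>2 / (2 * t)"
    using t by (simp add: field_simps)
  with inf_conv_le[OF assms, of "x - h"] show ?thesis by simp
qed

lemma inf_conv_shift_le_self:
  assumes "h \<in> range R"
  shows "inf_conv R t f (x - h) - 1 / t * (HR_norm R h)\<^sup>2 \<le> f x"
proof -
  have "0 \<le> (HR_norm R h)\<^sup>2 / (2 * t)" using t by simp
  with inf_conv_shift_le[OF assms, of x] show ?thesis by linarith
qed

lemma lasry_lions_ge:
  assumes "h \<in> range R"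
  shows "inf_conv R t f (x - h) - 1 / t * (HR_norm R h)\<^sup>2 \<le> lasry_lions R t f x"
  unfolding lasry_lions_eq
  by (rule cSUP_upper[OF assms bdd_aboveI2[OF inf_conv_shift_le_self]])

lemma lasry_lions_le:
  assumes "\<And>h. h \<in> range R \<Longrightarrow> inf_conv R t f (x - h) - 1 / t * (HR_norm R h)\<^sup>2 \<le> a"
  shows "lasry_lions R t f x \<le> a"
  unfolding lasry_lions_eq using assms by (intro cSUP_least) auto

lemma lasry_lions_le_self: "lasry_lions R t f x \<le> f x"
  by (rule lasry_lions_le) (rule inf_conv_shift_le_self)

lemma inf_conv_le_lasry_lions: "inf_conv R t f x \<le> lasry_lions R t f x"
  using lasry_lions_ge[OF zero_in_range, of x] by (simp add: HR_norm_0[OF R])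

lemma abs_lasry_lions_le: "\<bar>lasry_lions R t f x\<bar> \<le> B"
proof -
  have "- B \<le> inf_conv R t f x"
  proof (rule inf_conv_ge)
    fix k
    have "0 \<le> 1 / (2 * t) * (HR_norm R k)\<^sup>2" using t by simp
    then show "- B \<le> f (x + k) + 1 / (2 * t) * (HR_norm R k)\<^sup>2"
      using f_bound[of "x + k"] by linarith
  qed
  then show ?thesis
    using inf_conv_le_lasry_lions[of x] lasry_lions_le_self[of x] f_bound[of x] by linarith
qed

text \<open>The penalties do not involve \<open>x\<close>, so a bound on the increments of \<open>f\<close> in a fixed direction
  passes through the infimum and then through the supremum.\<close>

lemma lasry_lions_increment_le:
  assumes inc: "\<And>x. f (x + z) \<le> f x + e"
  shows "lasry_lions R t f (x + z) \<le> lasry_lions R t f x + e"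
proof -
  have V: "inf_conv R t f (y + z) - e \<le> inf_conv R t f y" for y
  proof (rule inf_conv_ge)
    fix k assume "k \<in> range R"
    from inf_conv_le[OF this, of "y + z"] inc[of "y + k"]
    show "inf_conv R t f (y + z) - e \<le> f (y + k) + 1 / (2 * t) * (HR_norm R k)\<^sup>2"
      by (simp add: algebra_simps)
  qed
  show ?thesis
  proof (rule lasry_lions_le)
    fix h assume "h \<in> range R"
    from lasry_lions_ge[OF this, of x] V[of "x - h"]
    show "inf_conv R t f (x + z - h) - 1 / t * (HR_norm R h)\<^sup>2 \<le> lasry_lions R t f x + e"
      by (simp add: algebra_simps)
  qed
qed

lemma uniformly_continuous_lasry_lions:
  assumes uc: "uniformly_continuous_on UNIV f"
  shows "uniformly_continuous_on UNIV (lasry_lions R t f)"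
  unfolding uniformly_continuous_on_def
proof (intro allI impI)
  fix e :: real assume "e > 0"
  then obtain d where d: "d > 0" and fd: "\<And>x y. dist y x < d \<Longrightarrow> dist (f y) (f x) < e / 2"
    using uc unfolding uniformly_continuous_on_def by (metis UNIV_I half_gt_zero)
  have "lasry_lions R t f y \<le> lasry_lions R t f x + e / 2" if "dist y x < d" for x y
  proof -
    have "f (w + (y - x)) \<le> f w + e / 2" for w
    proof -
      have "dist (w + (y - x)) w < d" using that by (simp add: dist_norm)
      from fd[OF this] show ?thesis by (simp add: dist_real_def abs_if split: if_splits)
    qed
    from lasry_lions_increment_le[of "y - x" "e / 2" x, OF this] show ?thesis by simp
  qed
  then have "dist (lasry_lions R t f y) (lasry_lions R t f x) < e" if "dist y x < d" for x y
    using that \<open>e > 0\<close> unfolding dist_real_def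
    by (smt (verit) dist_commute field_sum_of_halves)
  with d show "\<exists>d>0. \<forall>x\<in>UNIV. \<forall>x'\<in>UNIV.
      dist x' x < d \<longrightarrow> dist (lasry_lions R t f x') (lasry_lions R t f x) < e"
    by blast
qed

lemma self_minus_lasry_lions_le:
  assumes \<alpha>: "0 < \<alpha>" "\<alpha> < 1" and L: "0 \<le> L"
    and holder: "\<And>x v. \<bar>f (x + R v) - f x\<bar> \<le> L * norm v powr \<alpha>"
  shows "f x - lasry_lions R t f x
    \<le> 2 powr (\<alpha> / (2 - \<alpha>)) * L powr (2 / (2 - \<alpha>)) * t powr (\<alpha> / (2 - \<alpha>))" (is "_ \<le> ?M")
proof -
  have "f x - ?M \<le> inf_conv R t f x"
  proof (rule inf_conv_ge)
    fix k assume k: "k \<in> range R"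
    have "\<bar>f (x + k) - f x\<bar> \<le> L * HR_norm R k powr \<alpha>"
      using holder[of x "pinv R k"] R_pinv[OF R k] by (simp add: HR_norm_def)
    with holder_minus_quadratic_le[OF \<alpha> L HR_norm_nonneg[of R k] t]
    show "f x - ?M \<le> f (x + k) + 1 / (2 * t) * (HR_norm R k)\<^sup>2" by simp
  qed
  with inf_conv_le_lasry_lions[of x] show ?thesis by linarith
qed

text \<open>A near-maximizer \<open>h\<close> for \<open>x\<close>, translated to \<open>h + R v\<close>, competes at \<open>x + R v\<close>. Its
  size is controlled because \<open>inf_conv_shift_le\<close> bounds \<open>(HR_norm R h)\<^sup>2 / (2 * t)\<close> by the gap
  between \<open>f\<close> and its regularization.\<close>

lemma lasry_lions_lipschitz:
  assumes gap: "\<And>x. f x - lasry_lions R t f x \<le> M"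
  shows "lasry_lions R t f x - lasry_lions R t f (x + R v) \<le> 2 * sqrt (2 * M / t) * norm v"
proof (rule lipschitz_by_subdivision[where B = "1 / t"])
  show "linear R" by (rule bounded_linear.linear[OF R])
  fix x v
  let ?S = "lasry_lions R t f"
  have near: "?S x - ?S (x + R v)
      \<le> 2 * sqrt (2 * t * (M + e)) / t * norm v + 1 / t * (norm v)\<^sup>2 + e" if "e > 0" for e
  proof -
    obtain h where h: "h \<in> range R"
      and S_less: "?S x - e < inf_conv R t f (x - h) - 1 / t * (HR_norm R h)\<^sup>2"
    proof (rule ccontr)
      assume "\<not> thesis"
      then have "?S x \<le> ?S x - e" using that by (intro lasry_lions_le leI) blast
      with \<open>e > 0\<close> show False by simp
    qed
    have "(HR_norm R h)\<^sup>2 / (2 * t) \<le> M + e"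
      using inf_conv_shift_le[OF h, of x] S_less gap[of x] by linarith
    then have "(HR_norm R h)\<^sup>2 \<le> 2 * t * (M + e)" using t by (simp add: field_simps)
    then have Nh: "HR_norm R h \<le> sqrt (2 * t * (M + e))" by (rule real_le_rsqrt)
    have "h + R v \<in> range R"
      using h linear_add[OF bounded_linear.linear[OF R]] by (metis imageE rangeI)
    from lasry_lions_ge[OF this, of "x + R v"]
    have "inf_conv R t f (x - h) - 1 / t * (HR_norm R (h + R v))\<^sup>2 \<le> ?S (x + R v)"
      by simp
    with S_less have "?S x - ?S (x + R v)
        \<le> 1 / t * (HR_norm R (h + R v))\<^sup>2 - 1 / t * (HR_norm R h)\<^sup>2 + e" by linarith
    also have "\<dots> = 1 / t * ((HR_norm R (h + R v))\<^sup>2 - (HR_norm R h)\<^sup>2) + e"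
      by (simp add: algebra_simps)
    also have "\<dots> \<le> 1 / t * (2 * sqrt (2 * t * (M + e)) * norm v + (norm v)\<^sup>2) + e"
    proof -
      have "(HR_norm R (h + R v))\<^sup>2 \<le> (HR_norm R h + norm v)\<^sup>2"
        by (intro power_mono HR_norm_add_le R h HR_norm_nonneg)
      also have "\<dots> = (HR_norm R h)\<^sup>2 + 2 * HR_norm R h * norm v + (norm v)\<^sup>2"
        by (simp add: power2_eq_square algebra_simps)
      also have "2 * HR_norm R h * norm v \<le> 2 * sqrt (2 * t * (M + e)) * norm v"
        using Nh by (intro mult_right_mono) auto
      finally have "(HR_norm R (h + R v))\<^sup>2 - (HR_norm R h)\<^sup>2
          \<le> 2 * sqrt (2 * t * (M + e)) * norm v + (norm v)\<^sup>2" by simp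
      from mult_left_mono[OF this, of "1 / t"] t show ?thesis by simp
    qed
    finally show ?thesis by (simp add: algebra_simps add_divide_distrib)
  qed
  have "((\<lambda>e. 2 * sqrt (2 * t * (M + e)) / t * norm v + 1 / t * (norm v)\<^sup>2 + e)
      \<longlongrightarrow> 2 * sqrt (2 * t * (M + 0)) / t * norm v + 1 / t * (norm v)\<^sup>2 + 0) (at_right 0)"
    by (intro tendsto_intros) (use t in auto)
  moreover have "\<forall>\<^sub>F e in at_right 0. ?S x - ?S (x + R v)
      \<le> 2 * sqrt (2 * t * (M + e)) / t * norm v + 1 / t * (norm v)\<^sup>2 + e"
    using eventually_at_right_less by (rule eventually_mono) (rule near)
  ultimately have "?S x - ?S (x + R v)
      \<le> 2 * sqrt (2 * t * (M + 0)) / t * norm v + 1 / t * (norm v)\<^sup>2 + 0"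
    by (intro tendsto_lowerbound) auto
  moreover have "sqrt (2 * t * M) / t = sqrt (2 * M / t)"
  proof -
    have "sqrt (2 * t * M) / t = sqrt (2 * t * M / t\<^sup>2)" using t by (simp add: real_sqrt_divide)
    also have "2 * t * M / t\<^sup>2 = 2 * M / t" using t by (simp add: power2_eq_square)
    finally show ?thesis .
  qed
  ultimately show "?S x - ?S (x + R v) \<le> 2 * sqrt (2 * M / t) * norm v + 1 / t * (norm v)\<^sup>2"
    by (simp flip: times_divide_eq_right)
qed

end

section \<open>The extended-real seminorms as bounds\<close>

lemma abs_le_sup_norm:
  assumes "f \<in> BUC"
  shows "\<bar>f x\<bar> \<le> enn2real (sup_norm f)" and "sup_norm f < \<infinity>"
proof -
  obtain B where B: "\<And>x. \<bar>f x\<bar> \<le> B"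
    using assms by (auto simp: BUC_def bounded_iff)
  have "sup_norm f \<le> ennreal B"
    unfolding sup_norm_def by (intro SUP_least ennreal_leI B)
  then show fin: "sup_norm f < \<infinity>" using le_less_trans by fastforce
  have "ennreal \<bar>f x\<bar> \<le> sup_norm f" unfolding sup_norm_def by (rule SUP_upper) simp
  then have "enn2real (ennreal \<bar>f x\<bar>) \<le> enn2real (sup_norm f)"
    using fin by (intro enn2real_mono) auto
  then show "\<bar>f x\<bar> \<le> enn2real (sup_norm f)" by simp
qed

lemma holder_increment_le:
  assumes R: "linear R" and f: "f \<in> BUC_holder R \<alpha>"
  shows "\<bar>f (x + R v) - f x\<bar> \<le> enn2real (holder_seminorm R \<alpha> f) * norm v powr \<alpha>"
proof (cases "v = 0")
  case True
  then show ?thesis by (simp add: linear_0[OF R])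
next
  case False
  have fin: "holder_seminorm R \<alpha> f < \<infinity>" using f by (simp add: BUC_holder_def)
  have "ennreal (\<bar>f (x + R v) - f x\<bar> / norm v powr \<alpha>) \<le> holder_seminorm R \<alpha> f"
    unfolding holder_seminorm_def using False by (intro Sup_upper) blast
  then have "enn2real (ennreal (\<bar>f (x + R v) - f x\<bar> / norm v powr \<alpha>))
      \<le> enn2real (holder_seminorm R \<alpha> f)"
    using fin by (intro enn2real_mono) auto
  then show ?thesis using False by (simp add: field_simps)
qed

lemma lip_seminorm_le:
  assumes "\<And>x v. \<bar>g (x + R v) - g x\<bar> \<le> A * norm v"
  shows "lip_seminorm R g \<le> ennreal A"
  unfolding lip_seminorm_def
proof (rule Sup_least, clarify)
  fix x v :: 'a assume "v \<noteq> 0"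
  with assms[of x v] have "\<bar>g (x + R v) - g x\<bar> / norm v \<le> A" by (simp add: field_simps)
  then show "ennreal (\<bar>g (x + R v) - g x\<bar> / norm v) \<le> ennreal A" by (rule ennreal_leI)
qed

section \<open>Regularization of Hoelder functions along the range of an operator\<close>

theorem proposition4p12:
  fixes \<alpha> :: real
  assumes "0 < \<alpha>" and "\<alpha> < 1"
  shows "\<exists>c>0. \<forall>(R :: 'a::{real_inner, polish_space} \<Rightarrow> 'a) f.
    bounded_linear R \<longrightarrow> self_adjoint R \<longrightarrow> f \<in> BUC_holder R \<alpha> \<longrightarrow>
    (\<forall>t>0.
       sup_norm (lasry_lions R t f) \<le> sup_norm f \<and>
       (\<forall>x. 0 \<le> f x - lasry_lions R t f x \<and>
            f x - lasry_lions R t f x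
              \<le> c * enn2real (holder_seminorm R \<alpha> f) powr (2 / (2 - \<alpha>))
                  * t powr (\<alpha> / (2 - \<alpha>))) \<and>
       lip_seminorm R (lasry_lions R t f)
         \<le> ennreal (2 * (2 * c * enn2real (holder_seminorm R \<alpha> f) powr (2 / (2 - \<alpha>))) powr (1 / 2)
                      * t powr ((\<alpha> - 1) / (2 - \<alpha>))) \<and>
       lasry_lions R t f \<in> Lip_b R)"
proof -
  define c :: real where "c = 2 powr (\<alpha> / (2 - \<alpha>))"
  have c: "c > 0" by (simp add: c_def)
  show ?thesis
  proof (rule exI[of _ c], rule conjI[OF c], intro allI impI)
    fix R :: "'a \<Rightarrow> 'a" and f :: "'a \<Rightarrow> real" and t :: real
    assume R: "bounded_linear R" and f: "f \<in> BUC_holder R \<alpha>" and t: "0 < t"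
    let ?S = "lasry_lions R t f"
    define L where "L = enn2real (holder_seminorm R \<alpha> f)"
    define K where "K = c * L powr (2 / (2 - \<alpha>))"
    have K: "K \<ge> 0" using c by (simp add: K_def)
    have "f \<in> BUC" using f by (simp add: BUC_holder_def)
    note fB = abs_le_sup_norm(1)[OF this] and fin = abs_le_sup_norm(2)[OF this]
    have SB: "\<bar>?S x\<bar> \<le> enn2real (sup_norm f)" for x
      by (rule abs_lasry_lions_le[OF R fB t])
    have "ennreal \<bar>?S x\<bar> \<le> sup_norm f" for x
      using ennreal_leI[OF SB[of x]] ennreal_enn2real[of "sup_norm f"] fin
      unfolding infinity_ennreal_def by (simp only:)
    then have sup: "sup_norm ?S \<le> sup_norm f"
      unfolding sup_norm_def[of ?S] by (rule SUP_least)
    have gap: "f x - ?S x \<le> K * t powr (\<alpha> / (2 - \<alpha>))" for x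
      using self_minus_lasry_lions_le[OF R fB t assms _
          holder_increment_le[OF bounded_linear.linear[OF R] f]]
      by (simp add: K_def c_def L_def)
    define A where "A = 2 * (2 * K) powr (1 / 2) * t powr ((\<alpha> - 1) / (2 - \<alpha>))"
    have A: "2 * sqrt (2 * (K * t powr (\<alpha> / (2 - \<alpha>))) / t) = A"
    proof -
      have "t powr (\<alpha> / (2 - \<alpha>)) / t = t powr (\<alpha> / (2 - \<alpha>) - 1)"
        using t by (simp add: powr_diff)
      also have "\<alpha> / (2 - \<alpha>) - 1 = 2 * ((\<alpha> - 1) / (2 - \<alpha>))"
        using assms by (simp add: field_simps)
      also have "t powr (2 * ((\<alpha> - 1) / (2 - \<alpha>))) = (t powr ((\<alpha> - 1) / (2 - \<alpha>)))\<^sup>2"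
        by (simp add: power2_eq_square flip: powr_add)
      finally have "2 * (K * t powr (\<alpha> / (2 - \<alpha>))) / t
          = 2 * K * (t powr ((\<alpha> - 1) / (2 - \<alpha>)))\<^sup>2"
        by (metis times_divide_eq_right mult.assoc)
      then show ?thesis using K by (simp add: A_def real_sqrt_mult powr_half_sqrt)
    qed
    have half: "?S x - ?S (x + R v) \<le> A * norm v" for x v
      using lasry_lions_lipschitz[OF R fB t gap] by (simp only: A)
    have "\<bar>?S (x + R v) - ?S x\<bar> \<le> A * norm v" for x v
      using half[of x v] half[of "x + R v" "- v"]
      by (simp add: linear_neg[OF bounded_linear.linear[OF R]] abs_le_iff)
    then have lip: "lip_seminorm R ?S \<le> ennreal A" by (rule lip_seminorm_le)
    have "uniformly_continuous_on UNIV ?S"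
      using uniformly_continuous_lasry_lions[OF R fB t] \<open>f \<in> BUC\<close> by (simp add: BUC_def)
    then have "?S \<in> BUC" using SB by (auto simp: BUC_def bounded_iff)
    moreover have "lip_seminorm R ?S < \<infinity>"
      using lip le_less_trans by fastforce
    ultimately have "?S \<in> Lip_b R" by (simp add: Lip_b_def)
    moreover have "0 \<le> f x - ?S x" for x
      using lasry_lions_le_self[OF R fB t] by simp
    ultimately show "sup_norm ?S \<le> sup_norm f \<and>
       (\<forall>x. 0 \<le> f x - ?S x \<and>
            f x - ?S x \<le> c * enn2real (holder_seminorm R \<alpha> f) powr (2 / (2 - \<alpha>))
                  * t powr (\<alpha> / (2 - \<alpha>))) \<and>
       lip_seminorm R ?S
         \<le> ennreal (2 * (2 * c * enn2real (holder_seminorm R \<alpha> f) powr (2 / (2 - \<alpha>))) powr (1 / 2)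
                      * t powr ((\<alpha> - 1) / (2 - \<alpha>))) \<and>
       ?S \<in> Lip_b R"
      using sup gap lip by (simp add: A_def K_def L_def mult.assoc)
  qed
qed

end
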